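(* Let $a = (a_n)_{n}$ be a non-decreasing sequence of positive reals such that (1) $\lim_{n\to\infty} \frac{a_n}{a_{n+1}} = 1$, and (2) $\sup_n \frac{a_{2n}}{a_n} < \infty$. Then $\mathcal{P}^a$ is a semigroup (i.e. closed under convolution) and $\psi_a \colon \mathcal{P}^a \to \mathbb{R}$ is a monotone additive statistic. If additionally $\sup_n \frac{a_n}{n} < \infty$, then $\mathcal{P}^1 \subsetneq \mathcal{P}^a$ (strict inclusion).
   Context: $\mathcal{P}$ is the set of Borel probability measures on $\mathbb{R}$, a commutative semigroup under convolution $\ast$. Stochastic order: $\mu \le \nu$ if and only if $\mu((-\infty,x]) \ge \nu((-\infty,x])$ for all $x \in \mathbb{R}$. For a subset $\mathcal{S} \subseteq \mathcal{P}$ closed under convolution, a map $\varphi \colon \mathcal{S} \to \mathbb{R}$ is a monotone additive statistic if $\varphi(\mu \ast \nu) = \varphi(\mu) + \varphi(\nu)$ for all $\mu,\nu \in \mathcal{S}$, and $\mu \le \nu$ implies $\varphi(\mu) \le \varphi(\nu)$ for all $\mu,\nu \in \mathcal{S}$. $\mathcal{P}^1$ is the set of all $\mu \in \mathcal{P}$ with $\int |x|\,\mathrm{d}\mu(x) < \infty$. For a sequence $a = (a_n)_{n}$ of positive reals, indexed by the positive integers, $\mathcal{P}^a \subseteq \mathcal{P}$ is the set of all $\mu \in \mathcal{P}$ for which the limit $$\psi_a(\mu) := \lim_{n\to\infty} a_n \cdot \mu((n,\infty))$$ exists and is finite. *)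

theory Defs
  imports "HOL-Probability.Probability"
begin

definition borel_probs :: "real measure set" where
  "borel_probs = {M. real_distribution M}"

definition stoch_le :: "real measure \<Rightarrow> real measure \<Rightarrow> bool" where
  "stoch_le M N \<longleftrightarrow> (\<forall>x. cdf M x \<ge> cdf N x)"

definition conv_semigroup :: "real measure set \<Rightarrow> bool" where
  "conv_semigroup S \<longleftrightarrow> S \<subseteq> borel_probs \<and> (\<forall>M\<in>S. \<forall>N\<in>S. (M \<star> N) \<in> S)"

definition monotone_additive_statistic :: "real measure set \<Rightarrow> (real measure \<Rightarrow> real) \<Rightarrow> bool" where
  "monotone_additive_statistic S \<phi> \<longleftrightarrow>
     conv_semigroup S \<and>
     (\<forall>M\<in>S. \<forall>N\<in>S. \<phi> (M \<star> N) = \<phi> M + \<phi> N) \<and>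
     (\<forall>M\<in>S. \<forall>N\<in>S. stoch_le M N \<longrightarrow> \<phi> M \<le> \<phi> N)"

definition P_one :: "real measure set" where
  "P_one = {M \<in> borel_probs. (\<integral>\<^sup>+x. ennreal \<bar>x\<bar> \<partial>M) < \<infinity>}"

(* Sequences indexed by the positive integers are functions on nat whose value at 0 is
   irrelevant: limits do not see it, and all other conditions are restricted to n \<ge> 1. *)

definition P_seq :: "(nat \<Rightarrow> real) \<Rightarrow> real measure set" where
  "P_seq a = {M \<in> borel_probs. convergent (\<lambda>n. a n * measure M {real n<..})}"

definition psi :: "(nat \<Rightarrow> real) \<Rightarrow> real measure \<Rightarrow> real" where
  "psi a M = lim (\<lambda>n. a n * measure M {real n<..})"

end

theory Submission
  imports Defs
begin

text \<open>
The reason for additivity is the principle of one big jump. For independent \<open>X\<close> and \<open>Y\<close> and a fixed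
level \<open>m\<close>, the event \<open>X + Y > n\<close> is, up to events whose probability becomes negligible, the disjoint
union of ``\<open>X\<close> is about \<open>n\<close> or larger while \<open>Y\<close> is of size at most \<open>m\<close>'' and the same with the roles
exchanged.

Displacing the threshold by \<open>m\<close> is harmless since \<open>a n / a (n + m)\<close> tends to 1, so each of the two
main events contributes the normalized tail limit of one summand. The remaining way to reach a large
sum is that both variables exceed \<open>m\<close>, and then one of them exceeds \<open>n / 2\<close>. Doubling and monotonicity
of \<open>a\<close> bound \<open>a n\<close> times the probability of exceeding \<open>n / 2\<close> uniformly in \<open>n\<close>, and the independent
factor, the probability of exceeding \<open>m\<close>, makes this contribution as small as desired for large \<open>m\<close>.
The two inequalities are \<open>upper_tail_convolution_le\<close> and \<open>upper_tail_convolution_ge\<close>; the passage to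
the limit, first in \<open>n\<close> and then in \<open>m\<close>, is \<open>normalized_tail_convolution\<close>. It gives closure under
convolution and additivity at once. Monotonicity holds before passing to the limit, because the
stochastic order is the pointwise order of the tails.

If \<open>a\<close> grows at most linearly and the first moment is finite, then \<open>n\<close> times the tail at \<open>n\<close> tends
to 0, hence so does the normalized tail. The inclusion is strict because a measure on the negative
half-line has no upper tail at all, whatever its first moment.
\<close>

section \<open>Tails of real distributions\<close>

abbreviation upper_tail :: "real measure \<Rightarrow> real \<Rightarrow> real" where
  "upper_tail M t \<equiv> measure M {t<..}"

lemma upper_tail_eq_cdf:
  assumes "real_distribution M"
  shows "upper_tail M t = 1 - cdf M t"
proof -
  interpret real_distribution M by fact
  have "UNIV - {..t} = {t<..}" by auto
  then show ?thesis
    using prob_compl[of "{..t}"] by (simp add: cdf_def)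
qed

lemma upper_tail_antimono:
  assumes "real_distribution M" "s \<le> t"
  shows "upper_tail M t \<le> upper_tail M s"
  using real_distribution.finite_borel_measure_M[OF assms(1), THEN finite_borel_measure.cdf_nondecreasing, OF assms(2)]
  by (simp add: upper_tail_eq_cdf[OF assms(1)])

lemma upper_tail_tendsto_0:
  assumes "real_distribution M"
  shows "(\<lambda>m. upper_tail M (real m)) \<longlonglongrightarrow> 0"
proof -
  interpret real_distribution M by fact
  have "(\<lambda>m. 1 - cdf M (real m)) \<longlonglongrightarrow> 1 - 1"
    by (intro tendsto_intros filterlim_compose[OF cdf_lim_at_top_prob] filterlim_real_sequentially)
  then show ?thesis by (simp add: upper_tail_eq_cdf[OF assms])
qed

lemma measure_centred_interval_tendsto_1:
  assumes "real_distribution M"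
  shows "(\<lambda>m. measure M {- real m<..real m}) \<longlonglongrightarrow> 1"
proof -
  interpret real_distribution M by fact
  have bot: "(\<lambda>m. cdf M (- real m)) \<longlonglongrightarrow> 0"
    by (intro filterlim_compose[OF cdf_lim_at_bot]
        filterlim_compose[OF filterlim_uminus_at_bot_at_top] filterlim_real_sequentially)
  have "(\<lambda>m. cdf M (real m) - cdf M (- real m)) \<longlonglongrightarrow> 1 - 0"
    by (intro tendsto_diff bot filterlim_compose[OF cdf_lim_at_top_prob] filterlim_real_sequentially)
  moreover have "\<forall>\<^sub>F m in sequentially.
      cdf M (real m) - cdf M (- real m) = measure M {- real m<..real m}"
    by (rule eventually_sequentiallyI[of 1]) (auto intro!: cdf_diff_eq)
  ultimately show ?thesis
    by (auto dest: Lim_transform_eventually)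
qed

section \<open>Tails of a convolution\<close>

lemma real_distribution_convolution:
  assumes "real_distribution M" "real_distribution N"
  shows "real_distribution (M \<star> N)"
proof -
  interpret M: real_distribution M by fact
  interpret N: real_distribution N by fact
  interpret P: pair_prob_space M N ..
  show ?thesis
    unfolding convolution_def by (rule P.real_distribution_distr) measurable
qed

lemma measure_pair_Times:
  assumes "real_distribution M" "real_distribution N" "A \<in> sets borel" "B \<in> sets borel"
  shows "measure (M \<Otimes>\<^sub>M N) (A \<times> B) = measure M A * measure N B"
proof -
  interpret M: real_distribution M by fact
  interpret N: real_distribution N by fact
  show ?thesis
    using assms by (simp add: measure_def N.emeasure_pair_measure_Times enn2real_mult)
qed

lemma upper_tail_convolution:
  assumes "real_distribution M" "real_distribution N"
  shows "upper_tail (M \<star> N) t = measure (M \<Otimes>\<^sub>M N) {z. t < fst z + snd z}"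
proof -
  interpret M: real_distribution M by fact
  interpret N: real_distribution N by fact
  have "(\<lambda>(x, y). x + y) -` {t<..} \<inter> space (M \<Otimes>\<^sub>M N) = {z. t < fst z + snd z}"
    by (auto simp: space_pair_measure)
  then show ?thesis
    unfolding convolution_def by (subst measure_distr) auto
qed

text \<open>A large sum needs a large summand. If neither \<open>x\<close> nor \<open>y\<close> exceeds \<open>t - s\<close> but \<open>x + y > t\<close>, then both
exceed \<open>s\<close> and one of them exceeds \<open>t / 2\<close>; by independence these last events have product probability,
which is what makes them negligible at the scale of a single tail.\<close>

lemma upper_tail_convolution_le:
  assumes M: "real_distribution M" and N: "real_distribution N"
  shows "upper_tail (M \<star> N) t \<le> upper_tail M (t - s) + upper_tail N (t - s)
    + upper_tail M (t / 2) * upper_tail N s + upper_tail M s * upper_tail N (t / 2)"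
proof -
  interpret M: real_distribution M by fact
  interpret N: real_distribution N by fact
  interpret P: pair_prob_space M N ..
  let ?A = "{t - s<..} \<times> UNIV" and ?B = "UNIV \<times> {t - s<..}"
  let ?C = "{t / 2<..} \<times> {s<..}" and ?D = "{s<..} \<times> {t / 2<..}"
  have "{z. t < fst z + snd z} \<subseteq> ?A \<union> ?B \<union> ?C \<union> ?D"
    by (auto simp: field_simps)
  then have "P.prob {z. t < fst z + snd z} \<le> P.prob (?A \<union> ?B \<union> ?C \<union> ?D)"
    by (intro P.finite_measure_mono) auto
  also have "\<dots> \<le> P.prob (?A \<union> ?B \<union> ?C) + P.prob ?D"
    by (intro measure_Un_le) auto
  also have "P.prob (?A \<union> ?B \<union> ?C) \<le> P.prob (?A \<union> ?B) + P.prob ?C"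
    by (intro measure_Un_le) auto
  also have "P.prob (?A \<union> ?B) \<le> P.prob ?A + P.prob ?B"
    by (intro measure_Un_le) auto
  finally show ?thesis
    using M.prob_space N.prob_space
    by (simp add: upper_tail_convolution[OF M N] measure_pair_Times[OF M N])
qed

text \<open>One summand beyond \<open>t + s\<close> suffices when the other lies in \<open>(-s, s]\<close>. The two ways in which this can
happen exclude each other, since \<open>t \<ge> 0\<close> puts \<open>t + s\<close> outside of \<open>(-s, s]\<close>, so their probabilities add.\<close>

lemma upper_tail_convolution_ge:
  assumes M: "real_distribution M" and N: "real_distribution N" and "0 \<le> t"
  shows "upper_tail M (t + s) * measure N {- s<..s} + measure M {- s<..s} * upper_tail N (t + s)
    \<le> upper_tail (M \<star> N) t"
proof -
  interpret M: real_distribution M by fact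
  interpret N: real_distribution N by fact
  interpret P: pair_prob_space M N ..
  have "{z \<in> space (M \<Otimes>\<^sub>M N). t < fst z + snd z} \<in> P.events" by measurable
  then have sum_event: "{z. t < fst z + snd z} \<in> P.events" by (simp add: space_pair_measure)
  let ?A = "{t + s<..} \<times> {- s<..s}" and ?B = "{- s<..s} \<times> {t + s<..}"
  have "?A \<inter> ?B = {}" using \<open>0 \<le> t\<close> by auto
  then have "P.prob ?A + P.prob ?B = P.prob (?A \<union> ?B)"
    by (intro P.finite_measure_Union[symmetric]) auto
  also have "\<dots> \<le> P.prob {z. t < fst z + snd z}"
    by (rule P.finite_measure_mono[OF _ sum_event]) (use \<open>0 \<le> t\<close> in auto)
  finally show ?thesis
    by (simp add: upper_tail_convolution[OF M N] measure_pair_Times[OF M N])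
qed

section \<open>Slowly changing normalizing sequences\<close>

lemma ratio_shift_tendsto_1:
  fixes a :: "nat \<Rightarrow> real"
  assumes pos: "\<And>n. n \<ge> 1 \<Longrightarrow> a n > 0"
    and ratio_lim: "(\<lambda>n. a n / a (Suc n)) \<longlonglongrightarrow> 1"
  shows "(\<lambda>n. a n / a (n + m)) \<longlonglongrightarrow> 1"
proof (induction m)
  case 0
  have nonzero: "a n \<noteq> 0" if "1 \<le> n" for n
    using pos[OF that] by simp
  have "\<forall>\<^sub>F n in sequentially. a n / a (n + 0) = 1"
    by (rule eventually_sequentiallyI[of 1]) (simp add: nonzero)
  then show ?case
    by (rule tendsto_eventually)
next
  case (Suc m)
  have nonzero: "a n \<noteq> 0" if "1 \<le> n" for n
    using pos[OF that] by simp
  have "(\<lambda>n. a n / a (n + m) * (a (n + m) / a (Suc (n + m)))) \<longlonglongrightarrow> 1 * 1"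
    by (intro tendsto_mult Suc.IH LIMSEQ_ignore_initial_segment[OF ratio_lim])
  moreover have "\<forall>\<^sub>F n in sequentially.
      a n / a (n + m) * (a (n + m) / a (Suc (n + m))) = a n / a (n + Suc m)"
    by (rule eventually_sequentiallyI[of 1]) (simp add: nonzero)
  ultimately have "(\<lambda>n. a n / a (n + Suc m)) \<longlonglongrightarrow> 1 * 1"
    by (rule Lim_transform_eventually)
  then show ?case by simp
qed

text \<open>Because finite shifts do not change \<open>a\<close> asymptotically, a tail displaced by a fixed amount, in this
direction or the other, has the same normalized limit.\<close>

lemma normalized_shift_left:
  fixes a :: "nat \<Rightarrow> real"
  assumes pos: "\<And>n. n \<ge> 1 \<Longrightarrow> a n > 0"
    and ratio_lim: "(\<lambda>n. a n / a (Suc n)) \<longlonglongrightarrow> 1"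
    and lim: "(\<lambda>n. a n * f n) \<longlonglongrightarrow> L"
  shows "(\<lambda>n. a n * f (n + m)) \<longlonglongrightarrow> L"
proof -
  have nonzero: "a n \<noteq> 0" if "1 \<le> n" for n
    using pos[OF that] by simp
  have "(\<lambda>n. a n / a (n + m) * (a (n + m) * f (n + m))) \<longlonglongrightarrow> 1 * L"
    by (intro tendsto_mult ratio_shift_tendsto_1 pos ratio_lim LIMSEQ_ignore_initial_segment[OF lim])
  moreover have "\<forall>\<^sub>F n in sequentially.
      a n / a (n + m) * (a (n + m) * f (n + m)) = a n * f (n + m)"
    by (rule eventually_sequentiallyI[of 1]) (simp add: nonzero)
  ultimately show ?thesis
    by (auto dest: Lim_transform_eventually)
qed

lemma normalized_shift_right:
  fixes a :: "nat \<Rightarrow> real"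
  assumes pos: "\<And>n. n \<ge> 1 \<Longrightarrow> a n > 0"
    and ratio_lim: "(\<lambda>n. a n / a (Suc n)) \<longlonglongrightarrow> 1"
    and lim: "(\<lambda>n. a n * f n) \<longlonglongrightarrow> L"
  shows "(\<lambda>n. a n * f (n - m)) \<longlonglongrightarrow> L"
proof (rule LIMSEQ_offset[where k = m])
  have nonzero: "a n \<noteq> 0" if "1 \<le> n" for n
    using pos[OF that] by simp
  have "(\<lambda>n. a n * f n / (a n / a (n + m))) \<longlonglongrightarrow> L / 1"
    by (intro tendsto_divide lim ratio_shift_tendsto_1 pos ratio_lim) auto
  moreover have "\<forall>\<^sub>F n in sequentially.
      a n * f n / (a n / a (n + m)) = a (n + m) * f (n + m - m)"
    by (rule eventually_sequentiallyI[of 1]) (simp add: nonzero)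
  ultimately show "(\<lambda>n. a (n + m) * f (n + m - m)) \<longlonglongrightarrow> L"
    by (auto dest: Lim_transform_eventually)
qed

text \<open>Doubling twice absorbs the rounding: \<open>n \<le> 4 * (n div 2)\<close> for \<open>n \<ge> 2\<close>, odd \<open>n\<close> included.\<close>

lemma doubling_half_le:
  fixes a :: "nat \<Rightarrow> real"
  assumes pos: "\<And>n. n \<ge> 1 \<Longrightarrow> a n > 0"
    and nondecreasing: "mono_on {1..} a"
    and doubling: "bdd_above ((\<lambda>n. a (2 * n) / a n) ` {1..})"
  obtains C where "C > 0" "\<And>n. n \<ge> 2 \<Longrightarrow> a n \<le> C * a (n div 2)"
proof -
  obtain D where D': "\<And>n. n \<in> {1..} \<Longrightarrow> a (2 * n) / a n \<le> D"
    using doubling by (auto simp: bdd_above_def)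
  have D: "a (2 * n) \<le> D * a n" if "n \<ge> 1" for n
    using that pos[of n] D'[of n] by (simp add: pos_divide_le_eq)
  have "0 < D * a 1" using D[of 1] pos[of 2] by simp
  then have "D > 0" using pos[of 1] by (simp add: zero_less_mult_iff)
  show thesis
  proof
    show "D * D > 0" using \<open>D > 0\<close> by simp
    fix n :: nat assume "n \<ge> 2"
    then have j: "n div 2 \<ge> 1" by simp
    have "a n \<le> a (2 * (2 * (n div 2)))"
      by (rule mono_onD[OF nondecreasing]) (use \<open>n \<ge> 2\<close> in auto)
    also have "\<dots> \<le> D * a (2 * (n div 2))" by (rule D) (use j in simp)
    also have "\<dots> \<le> D * (D * a (n div 2))" using D[OF j] \<open>D > 0\<close> by simp
    finally show "a n \<le> D * D * a (n div 2)" by simp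
  qed
qed

text \<open>Halving the threshold may change the normalized limit, or destroy it, but boundedness survives. This
is all that the exceptional events of \<open>upper_tail_convolution_le\<close> require, because there the half
tail is multiplied by a factor that can be made small.\<close>

lemma normalized_half_tail_bounded:
  fixes a :: "nat \<Rightarrow> real"
  assumes pos: "\<And>n. n \<ge> 1 \<Longrightarrow> a n > 0"
    and nondecreasing: "mono_on {1..} a"
    and doubling: "bdd_above ((\<lambda>n. a (2 * n) / a n) ` {1..})"
    and M: "real_distribution M"
    and lim: "(\<lambda>n. a n * upper_tail M (real n)) \<longlonglongrightarrow> L"
  obtains B where "\<And>n. n \<ge> 2 \<Longrightarrow> a n * upper_tail M (real n / 2) \<le> B"
proof -
  obtain C where C: "C > 0" "\<And>n. n \<ge> 2 \<Longrightarrow> a n \<le> C * a (n div 2)"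
    using doubling_half_le[OF pos nondecreasing doubling] by blast
  have "Bseq (\<lambda>n. a n * upper_tail M (real n))"
    using lim convergent_imp_Bseq convergentI by blast
  then obtain K where K: "\<And>n. norm (a n * upper_tail M (real n)) \<le> K"
    by (auto simp: Bseq_def)
  show thesis
  proof
    fix n :: nat assume n: "n \<ge> 2"
    let ?j = "n div 2"
    have "real ?j \<le> real n / 2" by linarith
    then have "a n * upper_tail M (real n / 2) \<le> a n * upper_tail M (real ?j)"
      using pos[of n] n by (intro mult_left_mono upper_tail_antimono[OF M]) auto
    also have "\<dots> \<le> C * a ?j * upper_tail M (real ?j)"
      by (intro mult_right_mono C n) simp
    also have "\<dots> = C * (a ?j * upper_tail M (real ?j))" by simp
    also have "\<dots> \<le> C * K"
      using K[of ?j] C(1) by (intro mult_left_mono) auto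
    finally show "a n * upper_tail M (real n / 2) \<le> C * K" .
  qed
qed

section \<open>Additivity of the normalized tail limit\<close>

text \<open>A squeeze with a truncation parameter: no single pair of bounds needs to pinch the limit, only the
limits of the bounds as the parameter grows.\<close>

lemma tendsto_sandwich_family:
  fixes s :: "nat \<Rightarrow> real"
  assumes lower: "\<And>m. \<forall>\<^sub>F n in sequentially. l m n \<le> s n"
    and upper: "\<And>m. \<forall>\<^sub>F n in sequentially. s n \<le> u m n"
    and l: "\<And>m. l m \<longlonglongrightarrow> l' m" and u: "\<And>m. u m \<longlonglongrightarrow> u' m"
    and l': "l' \<longlonglongrightarrow> c" and u': "u' \<longlonglongrightarrow> c"
  shows "s \<longlonglongrightarrow> c"
proof (rule order_tendstoI)
  fix e assume "e < c"
  then obtain m where "e < l' m"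
    using order_tendstoD(1)[OF l'] eventually_happens'[OF sequentially_bot] by blast
  from order_tendstoD(1)[OF l this] lower[of m] show "\<forall>\<^sub>F n in sequentially. e < s n"
    by eventually_elim simp
next
  fix e assume "c < e"
  then obtain m where "u' m < e"
    using order_tendstoD(2)[OF u'] eventually_happens'[OF sequentially_bot] by blast
  from order_tendstoD(2)[OF u this] upper[of m] show "\<forall>\<^sub>F n in sequentially. s n < e"
    by eventually_elim simp
qed

lemma normalized_tail_convolution:
  fixes a :: "nat \<Rightarrow> real"
  assumes pos: "\<And>n. n \<ge> 1 \<Longrightarrow> a n > 0"
    and nondecreasing: "mono_on {1..} a"
    and ratio_lim: "(\<lambda>n. a n / a (Suc n)) \<longlonglongrightarrow> 1"
    and doubling: "bdd_above ((\<lambda>n. a (2 * n) / a n) ` {1..})"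
    and M: "real_distribution M" and N: "real_distribution N"
    and limM: "(\<lambda>n. a n * upper_tail M (real n)) \<longlonglongrightarrow> K"
    and limN: "(\<lambda>n. a n * upper_tail N (real n)) \<longlonglongrightarrow> L"
  shows "(\<lambda>n. a n * upper_tail (M \<star> N) (real n)) \<longlonglongrightarrow> K + L"
proof -
  obtain B where B: "\<And>n. n \<ge> 2 \<Longrightarrow> a n * upper_tail M (real n / 2) \<le> B"
    using normalized_half_tail_bounded[OF pos nondecreasing doubling M limM] by blast
  obtain B' where B': "\<And>n. n \<ge> 2 \<Longrightarrow> a n * upper_tail N (real n / 2) \<le> B'"
    using normalized_half_tail_bounded[OF pos nondecreasing doubling N limN] by blast
  \<comment> \<open>In these bounds the truncation level \<open>m\<close> stays fixed while \<open>n\<close> grows; letting \<open>m\<close> grow afterwards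
    sends the interval masses to 1 and the exceptional terms to 0.\<close>
  define l where "l m n = a n * upper_tail M (real (n + m)) * measure N {- real m<..real m}
      + measure M {- real m<..real m} * (a n * upper_tail N (real (n + m)))" for m n
  define u where "u m n = a n * upper_tail M (real (n - m)) + a n * upper_tail N (real (n - m))
      + (B * upper_tail N (real m) + upper_tail M (real m) * B')" for m n
  show ?thesis
  proof (rule tendsto_sandwich_family)
    show "\<forall>\<^sub>F n in sequentially. l m n \<le> a n * upper_tail (M \<star> N) (real n)" for m
    proof (rule eventually_sequentiallyI[of 1])
      fix n :: nat assume "1 \<le> n"
      from mult_left_mono[OF upper_tail_convolution_ge[OF M N, of "real n" "real m"], of "a n"]
      show "l m n \<le> a n * upper_tail (M \<star> N) (real n)"
        using pos[OF \<open>1 \<le> n\<close>] by (simp add: l_def algebra_simps)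
    qed
    show "\<forall>\<^sub>F n in sequentially. a n * upper_tail (M \<star> N) (real n) \<le> u m n" for m
    proof (rule eventually_sequentiallyI[of "m + 2"])
      fix n :: nat assume n: "m + 2 \<le> n"
      have half: "a n * upper_tail M (real n / 2) * upper_tail N (real m) \<le> B * upper_tail N (real m)"
        "upper_tail M (real m) * (a n * upper_tail N (real n / 2)) \<le> upper_tail M (real m) * B'"
        using n by (auto intro!: mult_right_mono mult_left_mono B B')
      have "a n * upper_tail (M \<star> N) (real n)
          \<le> a n * upper_tail M (real (n - m)) + a n * upper_tail N (real (n - m))
            + (a n * upper_tail M (real n / 2) * upper_tail N (real m)
               + upper_tail M (real m) * (a n * upper_tail N (real n / 2)))"
        using mult_left_mono[OF upper_tail_convolution_le[OF M N, of "real n" "real m"], of "a n"]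
          pos[of n] n by (simp add: algebra_simps of_nat_diff)
      with half show "a n * upper_tail (M \<star> N) (real n) \<le> u m n"
        by (simp add: u_def)
    qed
    show "l m \<longlonglongrightarrow> K * measure N {- real m<..real m} + measure M {- real m<..real m} * L" for m
      unfolding l_def
      by (intro tendsto_add tendsto_mult tendsto_const
          normalized_shift_left[OF pos ratio_lim limM] normalized_shift_left[OF pos ratio_lim limN])
    show "u m \<longlonglongrightarrow> K + L + (B * upper_tail N (real m) + upper_tail M (real m) * B')" for m
      unfolding u_def
      by (intro tendsto_add tendsto_const
          normalized_shift_right[OF pos ratio_lim limM] normalized_shift_right[OF pos ratio_lim limN])
    have "(\<lambda>m. K * measure N {- real m<..real m} + measure M {- real m<..real m} * L)
        \<longlonglongrightarrow> K * 1 + 1 * L"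
      by (intro tendsto_add tendsto_mult tendsto_const measure_centred_interval_tendsto_1 M N)
    then show "(\<lambda>m. K * measure N {- real m<..real m} + measure M {- real m<..real m} * L)
        \<longlonglongrightarrow> K + L" by simp
    have "(\<lambda>m. K + L + (B * upper_tail N (real m) + upper_tail M (real m) * B'))
        \<longlonglongrightarrow> K + L + (B * 0 + 0 * B')"
      by (intro tendsto_add tendsto_mult tendsto_const upper_tail_tendsto_0 M N)
    then show "(\<lambda>m. K + L + (B * upper_tail N (real m) + upper_tail M (real m) * B'))
        \<longlonglongrightarrow> K + L" by simp
  qed
qed

lemma P_seq_eq:
  "P_seq a = {M. real_distribution M \<and> (\<lambda>n. a n * upper_tail M (real n)) \<longlonglongrightarrow> psi a M}"
  by (auto simp: P_seq_def psi_def borel_probs_def convergent_LIMSEQ_iff)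

lemma psi_eqI:
  "(\<lambda>n. a n * upper_tail M (real n)) \<longlonglongrightarrow> L \<Longrightarrow> psi a M = L"
  by (simp add: psi_def limI)

section \<open>Comparison with the first moment\<close>

lemma linear_normalized_tail_tendsto_0:
  assumes "M \<in> P_one"
  shows "(\<lambda>n. real n * upper_tail M (real n)) \<longlonglongrightarrow> 0"
proof -
  interpret real_distribution M using assms by (simp add: P_one_def borel_probs_def)
  \<comment> \<open>Markov's inequality restricted to the tail: \<open>n\<close> is at most \<open>\<bar>x\<bar>\<close> there, and the integral of
    \<open>\<bar>x\<bar>\<close> over \<open>x > n\<close> vanishes in the limit by dominated convergence.\<close>
  have int: "integrable M (\<lambda>x. \<bar>x\<bar>)"
    using assms by (simp add: P_one_def integrable_iff_bounded)
  have lim: "(\<lambda>n. \<integral>x. indicator {real n<..} x * \<bar>x\<bar> \<partial>M) \<longlonglongrightarrow> (\<integral>x. 0 \<partial>M)"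
  proof (rule integral_dominated_convergence[where w = "\<lambda>x. \<bar>x\<bar>"])
    show "AE x in M. (\<lambda>n. indicator {real n<..} x * \<bar>x\<bar>) \<longlonglongrightarrow> 0"
    proof (rule AE_I2)
      fix x :: real
      have "x \<le> real n" if "nat \<lceil>x\<rceil> \<le> n" for n
        using that by linarith
      then have "\<forall>\<^sub>F n in sequentially. indicator {real n<..} x * \<bar>x\<bar> = 0"
        by (intro eventually_sequentiallyI[of "nat \<lceil>x\<rceil>"]) (auto simp: indicator_def not_less)
      then show "(\<lambda>n. indicator {real n<..} x * \<bar>x\<bar>) \<longlonglongrightarrow> 0"
        by (rule tendsto_eventually)
    qed
  qed (use int in \<open>auto simp: indicator_def\<close>)
  have le: "real n * upper_tail M (real n) \<le> (\<integral>x. indicator {real n<..} x * \<bar>x\<bar> \<partial>M)" for n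
  proof -
    have "real n * upper_tail M (real n) = (\<integral>x. real n * indicator {real n<..} x \<partial>M)"
      by simp
    also have "\<dots> \<le> (\<integral>x. indicator {real n<..} x * \<bar>x\<bar> \<partial>M)"
    proof (rule integral_mono)
      show "integrable M (\<lambda>x. indicator {real n<..} x * \<bar>x\<bar>)"
        by (rule Bochner_Integration.integrable_bound[OF int]) (auto simp: indicator_def)
      show "integrable M (\<lambda>x. real n * indicator {real n<..} x)"
        by (intro integrable_mult_right integrable_real_indicator) (auto simp: emeasure_eq_measure)
    qed (auto simp: indicator_def)
    finally show ?thesis .
  qed
  show ?thesis
  proof (rule tendsto_sandwich[OF _ _ tendsto_const lim[simplified]])
    show "\<forall>\<^sub>F n in sequentially.
        real n * upper_tail M (real n) \<le> (\<integral>x. indicator {real n<..} x * \<bar>x\<bar> \<partial>M)"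
      by (intro always_eventually allI le)
  qed simp
qed

lemma P_one_subset_P_seq:
  fixes a :: "nat \<Rightarrow> real"
  assumes pos: "\<And>n. n \<ge> 1 \<Longrightarrow> a n > 0"
    and linear: "bdd_above ((\<lambda>n. a n / real n) ` {1..})"
  shows "P_one \<subseteq> P_seq a"
proof
  fix M assume M: "M \<in> P_one"
  obtain C where "\<And>n. n \<in> {1..} \<Longrightarrow> a n / real n \<le> C"
    using linear by (auto simp: bdd_above_def)
  then have C: "a n \<le> C * real n" if "n \<ge> 1" for n
    using that by (simp add: pos_divide_le_eq)
  have "(\<lambda>n. C * (real n * upper_tail M (real n))) \<longlonglongrightarrow> C * 0"
    by (intro tendsto_mult tendsto_const linear_normalized_tail_tendsto_0 M)
  then have lim: "(\<lambda>n. C * (real n * upper_tail M (real n))) \<longlonglongrightarrow> 0" by simp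
  have "(\<lambda>n. a n * upper_tail M (real n)) \<longlonglongrightarrow> 0"
  proof (rule tendsto_sandwich[OF _ _ tendsto_const lim])
    show "\<forall>\<^sub>F n in sequentially. 0 \<le> a n * upper_tail M (real n)"
      by (rule eventually_sequentiallyI[of 1]) (use pos in \<open>simp add: less_imp_le\<close>)
    show "\<forall>\<^sub>F n in sequentially. a n * upper_tail M (real n) \<le> C * (real n * upper_tail M (real n))"
      by (rule eventually_sequentiallyI[of 1])
        (use C in \<open>simp add: mult_right_mono flip: mult.assoc\<close>)
  qed
  then show "M \<in> P_seq a"
    using M by (auto simp: P_seq_def P_one_def convergent_def)
qed

text \<open>The law of \<open>-(2 ^ k)\<close> for geometric \<open>k\<close> with parameter 1/2, as in the St. Petersburg game with the
sign reversed. The first moment diverges on the negative half-line, where \<open>psi\<close> does not look.\<close>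

definition negative_heavy_tail :: "real measure" where
  "negative_heavy_tail = distr (measure_pmf (geometric_pmf (1 / 2))) borel (\<lambda>k. - (2 ^ k))"

lemma real_distribution_negative_heavy_tail: "real_distribution negative_heavy_tail"
  unfolding negative_heavy_tail_def
  by (rule prob_space.real_distribution_distr[OF measure_pmf.prob_space_axioms]) simp

lemma negative_heavy_tail_notin_P_one: "negative_heavy_tail \<notin> P_one"
proof -
  have "(\<integral>\<^sup>+x. ennreal \<bar>x\<bar> \<partial>negative_heavy_tail)
      = (\<integral>\<^sup>+k. ennreal (2 ^ k) \<partial>measure_pmf (geometric_pmf (1 / 2)))"
    unfolding negative_heavy_tail_def by (subst nn_integral_distr) auto
  \<comment> \<open>Each \<open>k\<close> contributes \<open>2 ^ k * (1 / 2) ^ (k + 1) = 1 / 2\<close>.\<close>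
  also have "\<dots> = (\<integral>\<^sup>+k. ennreal (1 / 2) \<partial>count_space (UNIV :: nat set))"
    unfolding nn_integral_measure_pmf
    by (intro nn_integral_cong)
      (simp add: power_one_over flip: ennreal_mult)
  also have "\<dots> = \<infinity>"
    by (simp add: ennreal_mult_top)
  finally show ?thesis
    by (simp add: P_one_def)
qed

lemma negative_heavy_tail_in_P_seq: "negative_heavy_tail \<in> P_seq a"
proof -
  have "upper_tail negative_heavy_tail (real n) = 0" for n
  proof -
    have "\<not> real n < - (2 ^ k)" for k :: nat
      by (simp add: not_less order_trans[of _ 0])
    then have "(\<lambda>k. - (2 ^ k)) -` {real n<..} = ({} :: nat set)" by auto
    then show ?thesis
      unfolding negative_heavy_tail_def by (subst measure_distr) auto
  qed
  then show ?thesis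
    using real_distribution_negative_heavy_tail
    by (simp add: P_seq_def borel_probs_def convergent_const)
qed

section \<open>The tail limit as a monotone additive statistic\<close>

theorem theorem3:
  fixes a :: "nat \<Rightarrow> real"
  assumes pos: "\<And>n. n \<ge> 1 \<Longrightarrow> a n > 0"
    and nondecreasing: "mono_on {1..} a"
    and ratio_lim: "(\<lambda>n. a n / a (Suc n)) \<longlonglongrightarrow> 1"
    and doubling: "bdd_above ((\<lambda>n. a (2 * n) / a n) ` {1..})"
  shows "conv_semigroup (P_seq a) \<and>
         monotone_additive_statistic (P_seq a) (psi a) \<and>
         (bdd_above ((\<lambda>n. a n / real n) ` {1..}) \<longrightarrow> P_one \<subset> P_seq a)"
proof (intro conjI impI)
  have conv: "(\<lambda>n. a n * upper_tail (M \<star> N) (real n)) \<longlonglongrightarrow> psi a M + psi a N"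
    if "M \<in> P_seq a" "N \<in> P_seq a" for M N
    using that normalized_tail_convolution[OF pos nondecreasing ratio_lim doubling]
    by (simp add: P_seq_eq)
  show semigroup: "conv_semigroup (P_seq a)"
    using conv
    by (auto simp: conv_semigroup_def P_seq_def borel_probs_def convergent_def
        intro: real_distribution_convolution)
  have mono: "psi a M \<le> psi a N" if "M \<in> P_seq a" "N \<in> P_seq a" "stoch_le M N" for M N
  proof (rule LIMSEQ_le)
    show "(\<lambda>n. a n * upper_tail M (real n)) \<longlonglongrightarrow> psi a M"
      "(\<lambda>n. a n * upper_tail N (real n)) \<longlonglongrightarrow> psi a N"
      using that by (auto simp: P_seq_eq)
    have "a n * upper_tail M (real n) \<le> a n * upper_tail N (real n)" if "n \<ge> 1" for n
      using pos[OF that] \<open>M \<in> P_seq a\<close> \<open>N \<in> P_seq a\<close> \<open>stoch_le M N\<close>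
      by (simp add: P_seq_eq upper_tail_eq_cdf stoch_le_def)
    then show "\<exists>k. \<forall>n\<ge>k. a n * upper_tail M (real n) \<le> a n * upper_tail N (real n)"
      by blast
  qed
  show "monotone_additive_statistic (P_seq a) (psi a)"
    unfolding monotone_additive_statistic_def
    using semigroup psi_eqI[OF conv] mono by blast
  assume "bdd_above ((\<lambda>n. a n / real n) ` {1..})"
  then have "P_one \<subseteq> P_seq a"
    using P_one_subset_P_seq[of a] pos by blast
  then show "P_one \<subset> P_seq a"
    using negative_heavy_tail_in_P_seq negative_heavy_tail_notin_P_one by blast
qed

end
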